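(* Let $n\geq 3$ and let $D_n=\langle a,b\mid a^2=b^2=(ab)^n=e\rangle$ be the dihedral group of order $2n$. If $S=\partial\{e,a,b\}$, then $$i\bigl(\operatorname{Cay}(D_n,S)\bigr)=\lceil 2n/5\rceil\qquad\text{and}\qquad \alpha\bigl(\operatorname{Cay}(D_n,S)\bigr)=\lfloor 2n/3\rfloor .$$
   Context: For a non-empty subset $A$ of a group $G$ with identity $e$, $\partial A=A^{-1}A\setminus\{e\}$, where $A^{-1}A=\{x^{-1}y\mid x,y\in A\}$. For a subset $S\subseteq G$ with $e\notin S$ and $S=S^{-1}$, the (left) Cayley graph $\operatorname{Cay}(G,S)$ is the simple graph with vertex set $G$ in which $u,v$ are adjacent if and only if $vu^{-1}\in S$. For a finite graph $\Gamma$, $\alpha(\Gamma)$ is the size of a largest independent set and $i(\Gamma)$ is the size of a smallest maximal (with respect to inclusion) independent set. *)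

theory Defs
  imports "HOL-Algebra.Group" "Graph_Theory.Pair_Digraph" Complex_Main
begin

section \<open>Group presentations\<close>

text \<open>
  A letter \<open>(x, True)\<close> stands for the generator \<open>x\<close> and \<open>(x, False)\<close> for its formal inverse.
  The group presented by the relations \<open>u = v\<close>, \<open>(u, v) \<in> R\<close>, on the generators of type \<open>'x\<close>
  is the quotient of the monoid of words by the least congruence that contains \<open>R\<close> and
  cancels adjacent mutually inverse letters.
\<close>

type_synonym 'x gword = "('x \<times> bool) list"

inductive_set word_cong :: "'x gword rel \<Rightarrow> 'x gword rel" for R :: "'x gword rel" where
  refl: "(u, u) \<in> word_cong R"
| sym: "(u, v) \<in> word_cong R \<Longrightarrow> (v, u) \<in> word_cong R"
| trans: "(u, v) \<in> word_cong R \<Longrightarrow> (v, w) \<in> word_cong R \<Longrightarrow> (u, w) \<in> word_cong R"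
| append: "(u, u') \<in> word_cong R \<Longrightarrow> (v, v') \<in> word_cong R \<Longrightarrow> (u @ v, u' @ v') \<in> word_cong R"
| cancel: "([(x, s), (x, \<not> s)], []) \<in> word_cong R"
| relation: "(u, v) \<in> R \<Longrightarrow> (u, v) \<in> word_cong R"

definition presented_group :: "'x gword rel \<Rightarrow> 'x gword set monoid" where
  "presented_group R =
    \<lparr>carrier = UNIV // word_cong R,
     monoid.mult = (\<lambda>X Y. \<Union>u\<in>X. \<Union>v\<in>Y. word_cong R `` {u @ v}),
     one = word_cong R `` {[]}\<rparr>"

definition presented_gen :: "'x gword rel \<Rightarrow> 'x \<Rightarrow> 'x gword set" where
  "presented_gen R x = word_cong R `` {[(x, True)]}"

lemma equiv_word_cong: "equiv UNIV (word_cong R)"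
  by (intro equivI refl_onI symI transI) (auto intro: word_cong.refl word_cong.sym word_cong.trans)

lemma word_class_in_carrier: "word_cong R `` {u} \<in> carrier (presented_group R)"
  by (simp add: presented_group_def quotientI)

lemma presented_group_one: "\<one>\<^bsub>presented_group R\<^esub> = word_cong R `` {[]}"
  by (simp add: presented_group_def)

lemma presented_group_mult:
  "word_cong R `` {u} \<otimes>\<^bsub>presented_group R\<^esub> word_cong R `` {v} = word_cong R `` {u @ v}"
proof -
  have "congruent2 (word_cong R) (word_cong R) (\<lambda>u v. word_cong R `` {u @ v})"
    by (intro congruent2I[OF equiv_word_cong equiv_word_cong] equiv_class_eq[OF equiv_word_cong])
       (auto intro: word_cong.append word_cong.refl)
  from UN_equiv_class2[OF equiv_word_cong equiv_word_cong this] show ?thesis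
    by (simp add: presented_group_def)
qed

lemma word_inverse:
  "(map (\<lambda>(x, s). (x, \<not> s)) (rev w) @ w, []) \<in> word_cong R"
proof (induction w)
  case Nil
  show ?case by (simp add: word_cong.refl)
next
  case (Cons l w)
  obtain x s where l: "l = (x, s)" by (cases l)
  let ?i = "map (\<lambda>(x, s). (x, \<not> s)) (rev w)"
  have "(?i @ ([(x, \<not> s), (x, \<not> \<not> s)] @ w), ?i @ ([] @ w)) \<in> word_cong R"
    by (intro word_cong.append word_cong.refl word_cong.cancel)
  with Cons.IH show ?case
    by (auto simp: l intro: word_cong.trans)
qed

lemma group_presented_group: "group (presented_group R)"
proof (rule groupI)
  have car: "carrier (presented_group R) = UNIV // word_cong R"
    by (simp add: presented_group_def)
  show "X \<otimes>\<^bsub>presented_group R\<^esub> Y \<in> carrier (presented_group R)"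
    if "X \<in> carrier (presented_group R)" "Y \<in> carrier (presented_group R)" for X Y
    using that by (auto simp: car presented_group_mult word_class_in_carrier[of R, unfolded car] elim!: quotientE)
  show "\<one>\<^bsub>presented_group R\<^esub> \<in> carrier (presented_group R)"
    by (simp add: presented_group_one word_class_in_carrier)
  show "X \<otimes>\<^bsub>presented_group R\<^esub> Y \<otimes>\<^bsub>presented_group R\<^esub> Z =
      X \<otimes>\<^bsub>presented_group R\<^esub> (Y \<otimes>\<^bsub>presented_group R\<^esub> Z)"
    if "X \<in> carrier (presented_group R)" "Y \<in> carrier (presented_group R)"
       "Z \<in> carrier (presented_group R)" for X Y Z
    using that by (auto simp: car presented_group_mult elim!: quotientE)
  show "\<one>\<^bsub>presented_group R\<^esub> \<otimes>\<^bsub>presented_group R\<^esub> X = X"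
    if "X \<in> carrier (presented_group R)" for X
    using that by (auto simp: car presented_group_mult presented_group_one elim!: quotientE)
  show "\<exists>Y\<in>carrier (presented_group R). Y \<otimes>\<^bsub>presented_group R\<^esub> X = \<one>\<^bsub>presented_group R\<^esub>"
    if "X \<in> carrier (presented_group R)" for X
  proof -
    from that obtain w where w: "X = word_cong R `` {w}" by (auto simp: car elim!: quotientE)
    let ?Y = "word_cong R `` {map (\<lambda>(x, s). (x, \<not> s)) (rev w)}"
    have "?Y \<otimes>\<^bsub>presented_group R\<^esub> X = \<one>\<^bsub>presented_group R\<^esub>"
      unfolding w presented_group_mult presented_group_one
      by (rule equiv_class_eq[OF equiv_word_cong word_inverse])
    moreover have "?Y \<in> carrier (presented_group R)" by (rule word_class_in_carrier)
    ultimately show ?thesis by blast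
  qed
qed


section \<open>Dihedral groups\<close>

datatype dihedral_letter = Gen_a | Gen_b

definition dihedral_relations :: "nat \<Rightarrow> dihedral_letter gword rel" where
  "dihedral_relations n =
    {([(Gen_a, True), (Gen_a, True)], []),
     ([(Gen_b, True), (Gen_b, True)], []),
     (concat (replicate n [(Gen_a, True), (Gen_b, True)]), [])}"

definition dihedral_group :: "nat \<Rightarrow> dihedral_letter gword set monoid" where
  "dihedral_group n = presented_group (dihedral_relations n)"

definition dihedral_a :: "nat \<Rightarrow> dihedral_letter gword set" where
  "dihedral_a n = presented_gen (dihedral_relations n) Gen_a"

definition dihedral_b :: "nat \<Rightarrow> dihedral_letter gword set" where
  "dihedral_b n = presented_gen (dihedral_relations n) Gen_b"

lemma group_dihedral_group: "group (dihedral_group n)"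
  by (simp add: dihedral_group_def group_presented_group)

lemma dihedral_gens_closed:
  "dihedral_a n \<in> carrier (dihedral_group n)" "dihedral_b n \<in> carrier (dihedral_group n)"
  by (simp_all add: dihedral_a_def dihedral_b_def presented_gen_def dihedral_group_def
      word_class_in_carrier)


section \<open>Difference sets and Cayley graphs\<close>

definition boundary_set :: "('a, 'm) monoid_scheme \<Rightarrow> 'a set \<Rightarrow> 'a set" where
  "boundary_set G A = {inv\<^bsub>G\<^esub> x \<otimes>\<^bsub>G\<^esub> y | x y. x \<in> A \<and> y \<in> A} - {\<one>\<^bsub>G\<^esub>}"

text \<open>
  Simple graphs are loop-free symmetric digraphs. A Cayley graph is of this kind only when
  \<open>S\<close> is closed under inverses and does not contain the identity.
\<close>

definition cayley_graph :: "('a, 'm) monoid_scheme \<Rightarrow> 'a set \<Rightarrow> 'a pair_pre_digraph" where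
  "cayley_graph G S =
    \<lparr>pverts = carrier G,
     parcs = {(u, v). u \<in> carrier G \<and> v \<in> carrier G \<and> v \<otimes>\<^bsub>G\<^esub> inv\<^bsub>G\<^esub> u \<in> S}\<rparr>"

lemma (in group) inv_boundary_set:
  assumes "A \<subseteq> carrier G" and "s \<in> boundary_set G A"
  shows "inv s \<in> boundary_set G A"
proof -
  from assms obtain x y where xy: "x \<in> A" "y \<in> A" "s = inv x \<otimes> y" "s \<noteq> \<one>"
    by (auto simp: boundary_set_def)
  have c: "x \<in> carrier G" "y \<in> carrier G" using xy assms(1) by auto
  have "inv s = inv y \<otimes> x" using c by (simp add: xy(3) inv_mult_group)
  moreover have "inv s \<noteq> \<one>" using c xy by (metis inv_closed inv_inv inv_one m_closed)
  ultimately show ?thesis using xy by (auto simp: boundary_set_def)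
qed

lemma (in group) cayley_graph_bidirected:
  assumes "S \<subseteq> carrier G" and "\<one> \<notin> S" and inv: "\<And>s. s \<in> S \<Longrightarrow> inv s \<in> S"
  shows "pair_bidirected_digraph (cayley_graph G S)"
proof
  show "symmetric (with_proj (cayley_graph G S))"
    unfolding symmetric_def
  proof (rule symI)
    fix u v assume "(u, v) \<in> arcs_ends (with_proj (cayley_graph G S))"
    then have uv: "u \<in> carrier G" "v \<in> carrier G" "v \<otimes> inv u \<in> S"
      by (auto simp: cayley_graph_def)
    have "u \<otimes> inv v = inv (v \<otimes> inv u)" using uv by (simp add: inv_mult_group)
    then show "(v, u) \<in> arcs_ends (with_proj (cayley_graph G S))"
      using uv inv by (auto simp: cayley_graph_def)
  qed
qed (use assms in \<open>auto simp: cayley_graph_def\<close>)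


section \<open>Independence numbers\<close>

definition independent_set :: "'a pair_pre_digraph \<Rightarrow> 'a set \<Rightarrow> bool" where
  "independent_set \<Gamma> I \<longleftrightarrow> I \<subseteq> pverts \<Gamma> \<and> (\<forall>u\<in>I. \<forall>v\<in>I. (u, v) \<notin> parcs \<Gamma>)"

definition maximal_independent_set :: "'a pair_pre_digraph \<Rightarrow> 'a set \<Rightarrow> bool" where
  "maximal_independent_set \<Gamma> I \<longleftrightarrow>
    independent_set \<Gamma> I \<and> (\<forall>J. independent_set \<Gamma> J \<and> I \<subseteq> J \<longrightarrow> J = I)"

text \<open>Both numbers are meaningful for finite graphs only.\<close>

definition independence_number :: "'a pair_pre_digraph \<Rightarrow> nat" where
  "independence_number \<Gamma> = Max (card ` {I. independent_set \<Gamma> I})"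

definition independent_domination_number :: "'a pair_pre_digraph \<Rightarrow> nat" where
  "independent_domination_number \<Gamma> = Min (card ` {I. maximal_independent_set \<Gamma> I})"

end

theory Submission
  imports Defs "HOL-Number_Theory.Cong"
begin

text \<open>
  Listing the elements of \<open>D\<^sub>n\<close> as \<open>e, a, ba, aba, \<dots>\<close> identifies them with \<open>\<int>/2n\<close>; left multiplication
  by \<open>a\<close> and \<open>b\<close> moves one step to the left or right, depending on the parity of the position. Since
  \<open>S = {a, b, ab, ba}\<close>, the Cayley graph is the square of the cycle of length \<open>N = 2n\<close>. The translates
  of an independent set by \<open>0, 1, 2\<close> are disjoint, and those of a maximal one by \<open>-2, \<dots>, 2\<close> cover
  everything. This gives the bounds \<open>N/3\<close> and \<open>N/5\<close>, which are attained by cyclic sets whose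
  consecutive gaps lie between 3 and 5.
\<close>

section \<open>Squares of cycles\<close>

text \<open>The vertices are indexed by all integers, so that offsets can be added without reduction
  modulo \<open>N\<close>. With \<open>N\<close> at least 3, no offset 1, -1, 2 or -2 is a multiple
  of \<open>N\<close>, which excludes loops.\<close>

locale cycle_square =
  fixes \<Gamma> :: "'a pair_pre_digraph" and N :: nat and f :: "int \<Rightarrow> 'a"
  assumes verts: "pverts \<Gamma> = range f"
    and f_eq_iff: "f i = f j \<longleftrightarrow> [i = j] (mod int N)"
    and arc_iff: "(f i, f j) \<in> parcs \<Gamma> \<longleftrightarrow> (\<exists>d\<in>{1, -1, 2, -2}. f j = f (i + d))"
    and N_ge: "N \<ge> 3"
begin

lemma f_add_cong: "f i = f j \<Longrightarrow> f (i + d) = f (j + d)"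
  by (simp add: f_eq_iff cong_add)

lemma verts_eq: "pverts \<Gamma> = f ` {0..<int N}"
proof -
  have "f k \<in> f ` {0..<int N}" for k
    by (rule image_eqI[of _ _ "k mod int N"]) (use N_ge in \<open>auto simp: f_eq_iff cong_def\<close>)
  then show ?thesis by (auto simp: verts)
qed

lemma inj_on_f: "inj_on f {0..<int N}"
  by (auto simp: inj_on_def f_eq_iff cong_def)

lemma card_verts: "card (pverts \<Gamma>) = N"
  by (simp add: verts_eq card_image inj_on_f)

lemma finite_verts: "finite (pverts \<Gamma>)"
  by (simp add: verts_eq)

lemma arc_offset:
  assumes "f j = f (i + d)" "\<bar>d\<bar> \<le> 2" "d \<noteq> 0"
  shows "(f i, f j) \<in> parcs \<Gamma>"
proof -
  have "d \<in> {1, -1, 2, -2}" using assms by auto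
  then show ?thesis using assms(1) by (auto simp: arc_iff)
qed

lemma no_loop: "(f i, f i) \<notin> parcs \<Gamma>"
proof
  assume "(f i, f i) \<in> parcs \<Gamma>"
  then obtain d where d: "d \<in> {1, -1, 2, -2}" "f i = f (i + d)" unfolding arc_iff by blast
  then have "int N dvd d" by (simp add: f_eq_iff cong_iff_dvd_diff)
  then have "int N \<le> \<bar>d\<bar>" using d(1) by (intro zdvd_imp_le) auto
  then show False using d(1) N_ge by auto
qed

lemma arc_sym:
  assumes "(f i, f j) \<in> parcs \<Gamma>"
  shows "(f j, f i) \<in> parcs \<Gamma>"
proof -
  from assms obtain d where d: "d \<in> {1, -1, 2, -2}" "f j = f (i + d)" unfolding arc_iff by blast
  from f_add_cong[OF d(2), of "-d"] have "f i = f (j + - d)" by simp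
  then show ?thesis using d(1) by (intro arc_offset[of i j "-d"]) auto
qed

section \<open>Bounds on independent sets by counting translates\<close>

lemma independent_card_le:
  assumes "independent_set \<Gamma> I"
  shows "3 * card I \<le> N"
proof -
  \<comment> \<open>\<open>g\<close> chooses an integer position for each vertex; only then can a
    vertex be translated.\<close>
  define g where "g = inv_into UNIV f"
  have I: "I \<subseteq> range f" "\<And>u v. u \<in> I \<Longrightarrow> v \<in> I \<Longrightarrow> (u, v) \<notin> parcs \<Gamma>"
    using assms by (auto simp: independent_set_def verts)
  have fg: "f (g x) = x" if "x \<in> I" for x
    using that I(1) by (auto simp: g_def f_inv_into_f)
  \<comment> \<open>Two translates that meet put the positions of x and y at distance at most 2. A
    nonzero distance would be an arc inside \<open>I\<close>; distance 0 forces x = y.\<close>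
  have "inj_on (\<lambda>(x, d). f (g x + d)) (I \<times> {0..2})"
  proof (rule inj_onI, clarify)
    fix x y :: 'a and d d' :: int
    assume *: "x \<in> I" "y \<in> I" "d \<in> {0..2}" "d' \<in> {0..2}" "f (g x + d) = f (g y + d')"
    from f_add_cong[OF *(5), of "-d'"] have e: "f (g y) = f (g x + (d - d'))"
      by (simp add: algebra_simps)
    have "d - d' = 0"
    proof (rule ccontr)
      assume "d - d' \<noteq> 0"
      with e *(3,4) have "(f (g x), f (g y)) \<in> parcs \<Gamma>" by (intro arc_offset) auto
      then show False using I(2) * fg by simp
    qed
    with e show "x = y \<and> d = d'" using fg * by simp
  qed
  then have "card (I \<times> {0..2::int}) \<le> card (pverts \<Gamma>)"
    by (rule card_inj_on_le) (auto simp: verts finite_verts[unfolded verts])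
  then show ?thesis by (simp add: card_verts card_cartesian_product mult.commute)
qed

lemma maximal_independent_card_ge:
  assumes "maximal_independent_set \<Gamma> I"
  shows "N \<le> 5 * card I"
proof -
  define g where "g = inv_into UNIV f"
  have ind: "independent_set \<Gamma> I"
    and max: "\<And>J. independent_set \<Gamma> J \<Longrightarrow> I \<subseteq> J \<Longrightarrow> J = I"
    using assms by (auto simp: maximal_independent_set_def)
  have I: "I \<subseteq> range f" "\<And>u v. u \<in> I \<Longrightarrow> v \<in> I \<Longrightarrow> (u, v) \<notin> parcs \<Gamma>"
    using ind by (auto simp: independent_set_def verts)
  have fg: "f (g x) = x" if "x \<in> I" for x
    using that I(1) by (auto simp: g_def f_inv_into_f)
  have "pverts \<Gamma> \<subseteq> (\<lambda>(x, d). f (g x + d)) ` (I \<times> {-2..2})"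
  proof
    fix v assume "v \<in> pverts \<Gamma>"
    then obtain k where v: "v = f k" by (auto simp: verts)
    have "\<exists>u\<in>I. \<exists>d\<in>{-2..2}. v = f (g u + d)"
    proof (cases "v \<in> I")
      case True
      then show ?thesis using fg by (intro bexI[of _ v] bexI[of _ 0]) auto
    next
      case False
      \<comment> \<open>By maximality v cannot be added, so it has a neighbour in \<open>I\<close>;
        the pair (v, v) is not to blame because there are no loops.\<close>
      then have "\<not> independent_set \<Gamma> (insert v I)" using max[of "insert v I"] by blast
      then obtain u where u: "u \<in> I" "(u, v) \<in> parcs \<Gamma> \<or> (v, u) \<in> parcs \<Gamma>"
        using I no_loop[of k] unfolding independent_set_def verts v by blast
      then have "(f (g u), f k) \<in> parcs \<Gamma>" using arc_sym fg by (metis v)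
      then obtain d where "d \<in> {1, -1, 2, -2}" "f k = f (g u + d)" unfolding arc_iff by blast
      then show ?thesis using u(1) by (intro bexI[of _ u] bexI[of _ d]) (auto simp: v)
    qed
    then show "v \<in> (\<lambda>(x, d). f (g x + d)) ` (I \<times> {-2..2})" by force
  qed
  moreover have "finite I" using I(1) finite_verts verts finite_subset by metis
  ultimately have "card (pverts \<Gamma>) \<le> card (I \<times> {-2..2::int})"
    by (meson surj_card_le finite_SigmaI finite_atLeastAtMost_int)
  then show ?thesis by (simp add: card_verts card_cartesian_product mult.commute)
qed

section \<open>Extremal sets with gaps between 3 and 5\<close>

text \<open>The first gaps are 5 and the last ones 3, with at most one gap in between.\<close>

definition spaced :: "nat \<Rightarrow> nat \<Rightarrow> int" where
  "spaced m i = min (5 * int i) (3 * int i + (int N - 3 * int m))"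

lemma spaced_bounds:
  assumes "3 * m \<le> N" "i < m"
  shows "0 \<le> spaced m i" "spaced m i \<le> int N - 3"
  using assms by (auto simp: spaced_def)

text \<open>Both terms of the minimum grow by at least 3 per step, hence so does the minimum. The
  upper bound is the same separation read around the cycle: it keeps the last element 3 away from
  the first.\<close>

lemma spaced_diff:
  assumes "3 * m \<le> N" "i < j" "j < m"
  shows "3 \<le> spaced m j - spaced m i" "spaced m j - spaced m i \<le> int N - 3"
  using assms by (auto simp: spaced_def min_def)

lemma inj_on_spaced:
  assumes "3 * m \<le> N"
  shows "inj_on (\<lambda>i. f (spaced m i)) {..<m}"
proof (rule inj_onI)
  fix i j assume *: "i \<in> {..<m}" "j \<in> {..<m}" "f (spaced m i) = f (spaced m j)"
  then have "spaced m i = spaced m j"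
    using spaced_bounds[OF assms] by (intro inj_onD[OF inj_on_f]) force+
  then show "i = j"
    using spaced_diff(1)[OF assms, of i j] spaced_diff(1)[OF assms, of j i] *
    by (cases i j rule: linorder_cases) auto
qed

lemma independent_spaced:
  assumes "3 * m \<le> N"
  shows "independent_set \<Gamma> ((\<lambda>i. f (spaced m i)) ` {..<m})"
proof -
  have less: "(f (spaced m i), f (spaced m j)) \<notin> parcs \<Gamma>" if "i < j" "j < m" for i j
  proof
    assume "(f (spaced m i), f (spaced m j)) \<in> parcs \<Gamma>"
    then obtain d where d: "d \<in> {1, -1, 2, -2}" "f (spaced m j) = f (spaced m i + d)"
      unfolding arc_iff by blast
    then have "int N dvd spaced m j - spaced m i - d"
      by (simp add: f_eq_iff cong_iff_dvd_diff algebra_simps)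
    \<comment> \<open>As |d| is at most 2, the margin of 3 at both ends leaves this number strictly
      between 0 and \<open>N\<close>, so it is no multiple of \<open>N\<close>.\<close>
    moreover have "0 < spaced m j - spaced m i - d" "spaced m j - spaced m i - d < int N"
      using spaced_diff[OF assms that] d(1) by auto
    ultimately show False using zdvd_not_zless by blast
  qed
  have "(f (spaced m i), f (spaced m j)) \<notin> parcs \<Gamma>" if "i < m" "j < m" for i j
    using less[of i j] less[of j i] that no_loop[of "spaced m i"] arc_sym
    by (cases i j rule: linorder_cases) auto
  then show ?thesis by (auto simp: independent_set_def verts)
qed

text \<open>The sequence starts at 0, so it must pass k at some step before it reaches a value above
  k.\<close>

lemma spaced_interval:
  assumes "3 * m \<le> N" "0 \<le> k" "k < spaced m m'"
  shows "\<exists>i<m'. spaced m i \<le> k \<and> k < spaced m (Suc i)"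
  using assms(3)
proof (induction m')
  case 0
  then show ?case using assms(1,2) by (simp add: spaced_def)
next
  case (Suc m')
  then show ?case by (metis less_Suc_eq not_le)
qed

text \<open>A point in a gap of length at most 5 is within distance 2 of one of its ends, so every
  vertex outside the set has a neighbour in it.\<close>

lemma maximal_independent_spaced:
  assumes "3 * m \<le> N" "N \<le> 5 * m"
  shows "maximal_independent_set \<Gamma> ((\<lambda>i. f (spaced m i)) ` {..<m})"
  unfolding maximal_independent_set_def
proof (intro conjI allI impI independent_spaced[OF assms(1)])
  fix J assume J: "independent_set \<Gamma> J \<and> (\<lambda>i. f (spaced m i)) ` {..<m} \<subseteq> J"
  have "x \<in> (\<lambda>i. f (spaced m i)) ` {..<m}" if "x \<in> J" for x
  proof -
    from that J obtain k where k: "x = f k" "0 \<le> k" "k < int N"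
      by (auto simp: independent_set_def verts_eq)
    \<comment> \<open>\<open>N \<le> 5 * m\<close> makes the second term the minimum at index m, so
      the positions close up to a full turn and index m stands for the vertex of index 0.\<close>
    have end_eq: "spaced m m = int N" and start_eq: "spaced m 0 = 0"
      using assms by (auto simp: spaced_def)
    obtain i where i: "i < m" "spaced m i \<le> k" "k < spaced m (Suc i)"
      using spaced_interval[OF assms(1) k(2), of m] k(3) end_eq by auto
    have gap: "spaced m (Suc i) - spaced m i \<le> 5" by (auto simp: spaced_def)
    have "\<exists>j<m. \<exists>d. \<bar>d\<bar> \<le> 2 \<and> x = f (spaced m j + d)"
    proof (cases "k - spaced m i \<le> 2")
      case True
      then show ?thesis using i k(1)
        by (intro exI[of _ i] conjI exI[of _ "k - spaced m i"]) auto
    next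
      case False
      let ?d = "k - spaced m (Suc i)"
      have d: "\<bar>?d\<bar> \<le> 2" using False gap i by auto
      show ?thesis
      \<comment> \<open>The right end of the last gap is not listed in the set; modulo
        \<open>N\<close> it is the element at position 0.\<close>
      proof (cases "Suc i = m")
        case True
        then have "x = f (spaced m 0 + ?d)"
          by (simp add: k(1) f_eq_iff end_eq start_eq cong_iff_dvd_diff)
        then show ?thesis using d i(1) by (intro exI[of _ 0]) auto
      next
        case False
        then show ?thesis using d i(1) k(1) by (intro exI[of _ "Suc i"] conjI exI[of _ ?d]) auto
      qed
    qed
    then obtain j d where j: "j < m" "\<bar>d\<bar> \<le> 2" "x = f (spaced m j + d)" by blast
    have "f (spaced m j) \<in> J" using J j(1) by auto
    then have "(f (spaced m j), x) \<notin> parcs \<Gamma>" using J that by (auto simp: independent_set_def)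
    then have "d = 0" using arc_offset[of k "spaced m j" d] j k(1) by auto
    then show ?thesis using j by auto
  qed
  then show "J = (\<lambda>i. f (spaced m i)) ` {..<m}" using J by auto
qed

section \<open>The two numbers for the square of a cycle\<close>

lemma finite_independent_sets: "finite {I. independent_set \<Gamma> I}"
  by (rule finite_subset[of _ "Pow (pverts \<Gamma>)"])
    (auto simp: independent_set_def finite_verts)

lemma independence_number_eq: "independence_number \<Gamma> = N div 3"
  unfolding independence_number_def
proof (rule Max_eqI)
  show "finite (card ` {I. independent_set \<Gamma> I})"
    using finite_independent_sets by blast
  show "y \<le> N div 3" if "y \<in> card ` {I. independent_set \<Gamma> I}" for y
    using that independent_card_le by (auto simp: less_eq_div_iff_mult_less_eq mult.commute)
  have "3 * (N div 3) \<le> N" by simp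
  from independent_spaced[OF this] card_image[OF inj_on_spaced[OF this]]
  show "N div 3 \<in> card ` {I. independent_set \<Gamma> I}"
    by (auto intro!: image_eqI)
qed

text \<open>The last two hypotheses fix m as \<open>N\<close>/5 rounded up; the first leaves room
  for m elements with gaps of at least 3.\<close>

lemma independent_domination_number_eq:
  assumes "3 * m \<le> N" "N \<le> 5 * m" "5 * m < N + 5"
  shows "independent_domination_number \<Gamma> = m"
  unfolding independent_domination_number_def
proof (rule Min_eqI)
  show "finite (card ` {I. maximal_independent_set \<Gamma> I})"
    by (rule finite_imageI, rule finite_subset[OF _ finite_independent_sets])
      (auto simp: maximal_independent_set_def)
  show "m \<le> y" if "y \<in> card ` {I. maximal_independent_set \<Gamma> I}" for y
    using that maximal_independent_card_ge assms(3) by fastforce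
  show "m \<in> card ` {I. maximal_independent_set \<Gamma> I}"
    using maximal_independent_spaced[OF assms(1,2)] card_image[OF inj_on_spaced[OF assms(1)]]
    by (auto intro!: image_eqI)
qed

end

section \<open>Normal forms in the dihedral group\<close>

text \<open>Left multiplication of the alternating words \<open>e, a, ba, aba, \<dots>\<close>, in terms of their lengths.\<close>

fun letter_step :: "dihedral_letter \<Rightarrow> int \<Rightarrow> int" where
  "letter_step Gen_a k = (if even k then k + 1 else k - 1)"
| "letter_step Gen_b k = (if even k then k - 1 else k + 1)"

text \<open>The rightmost letter acts first, so concatenation becomes composition. A letter and its
  formal inverse act alike because each generator acts as an involution.\<close>

definition word_step :: "dihedral_letter gword \<Rightarrow> int \<Rightarrow> int" where
  "word_step w k = foldr (\<lambda>l. letter_step (fst l)) w k"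

lemma word_step_simps [simp]:
  "word_step [] k = k"
  "word_step (l # w) k = letter_step (fst l) (word_step w k)"
  "word_step (u @ v) k = word_step u (word_step v k)"
  by (simp_all add: word_step_def)

lemma letter_step_invol: "letter_step x (letter_step x k) = k"
  by (cases x) auto

text \<open>A letter looks only at the parity of the position. As 2n is even, the action therefore
  descends to residues modulo 2n.\<close>

lemma word_step_add_even: "even t \<Longrightarrow> word_step w (k + t) = word_step w k + t"
proof (induction w)
  case (Cons l w)
  then show ?case by (cases "fst l") auto
qed simp

lemma word_step_cong:
  assumes "[i = j] (mod 2 * int n)"
  shows "[word_step w i = word_step w j] (mod 2 * int n)"
proof -
  from assms obtain t where t: "j = i + 2 * int n * t" by (auto simp: cong_iff_lin)
  have "word_step w j = word_step w i + 2 * int n * t"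
    unfolding t by (rule word_step_add_even) simp
  then show ?thesis by (auto simp: cong_iff_lin)
qed

lemma word_step_replicate_ab:
  "word_step (concat (replicate m [(Gen_a, True), (Gen_b, True)])) k =
    (if even k then k - 2 * int m else k + 2 * int m)"
  by (induction m) auto

text \<open>The defining relations act trivially modulo 2n: the generators are involutions and the
  n-th power of ab shifts by 2n. This is what separates elements of the presented group.\<close>

lemma word_step_word_cong:
  assumes "(u, v) \<in> word_cong (dihedral_relations n)"
  shows "[word_step u k = word_step v k] (mod 2 * int n)"
  using assms
proof (induction arbitrary: k)
  case (append u u' v v')
  then have "[word_step u (word_step v k) = word_step u' (word_step v' k)] (mod 2 * int n)"
    by (blast intro: word_step_cong cong_trans)
  then show ?case by simp
next
  case (relation u v)
  then show ?case
    by (auto simp: dihedral_relations_def word_step_replicate_ab cong_iff_dvd_diff letter_step_invol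
        simp del: letter_step.simps)
next
  case (cancel x s)
  then show ?case by (simp add: letter_step_invol)
qed (auto intro: cong_sym cong_trans)

section \<open>Reduction of words to alternating words\<close>

fun alt_word :: "nat \<Rightarrow> dihedral_letter gword" where
  "alt_word 0 = []"
| "alt_word (Suc k) = (if even k then Gen_a else Gen_b, True) # alt_word k"

lemma word_step_alt_word: "word_step (alt_word k) 0 = int k"
  by (induction k) auto

text \<open>\<open>alt_word (2 * m)\<close> is a power of ba, while the relation concerns ab; moving
  a letter b across turns one into the other.\<close>

lemma alt_word_double_snoc:
  "alt_word (2 * m) @ [(Gen_b, True)] =
    (Gen_b, True) # concat (replicate m [(Gen_a, True), (Gen_b, True)])"
  by (induction m) auto

lemma word_cong_square:
  "([(x, True), (x, True)], []) \<in> word_cong (dihedral_relations n)"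
  by (cases x) (auto intro!: word_cong.relation simp: dihedral_relations_def)

lemma word_cong_append_left:
  "(u, v) \<in> word_cong R \<Longrightarrow> (w @ u, w @ v) \<in> word_cong R"
  by (intro word_cong.append word_cong.refl)

lemma word_cong_append_right:
  "(u, v) \<in> word_cong R \<Longrightarrow> (u @ w, v @ w) \<in> word_cong R"
  by (intro word_cong.append word_cong.refl)

lemma word_cong_double_letter:
  "((x, True) # (x, True) # w, w) \<in> word_cong (dihedral_relations n)"
  using word_cong_append_right[OF word_cong_square, where w = w] by simp

text \<open>The word consisting of x, x and the inverse of x reduces to the inverse by the square
  relation and to x by cancellation.\<close>

lemma word_cong_letter:
  "([(x, s)], [(x, True)]) \<in> word_cong (dihedral_relations n)"
proof (cases s)
  case True
  then show ?thesis by (simp add: word_cong.refl)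
next
  case False
  have "([(x, True), (x, True), (x, False)], [(x, False)]) \<in> word_cong (dihedral_relations n)"
    by (rule word_cong_double_letter)
  moreover have "([(x, True), (x, True), (x, False)], [(x, True)]) \<in> word_cong (dihedral_relations n)"
    using word_cong_append_left[OF word_cong.cancel[of x True], of "[(x, True)]"] by simp
  ultimately show ?thesis using False by (auto intro: word_cong.sym word_cong.trans)
qed

text \<open>Append bb, rewrite the result as b, then the n-th power of ab, then b, and apply the
  relations to get bb and finally the empty word.\<close>

lemma alt_word_double: "(alt_word (2 * n), []) \<in> word_cong (dihedral_relations n)"
proof -
  let ?b = "(Gen_b, True)" and ?R = "word_cong (dihedral_relations n)"
  let ?w = "concat (replicate n [(Gen_a, True), ?b])"
  have "(alt_word (2 * n) @ [?b, ?b], alt_word (2 * n)) \<in> ?R"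
    using word_cong_append_left[OF word_cong_double_letter[of Gen_b "[]"]] by simp
  moreover have "alt_word (2 * n) @ [?b, ?b] = [?b] @ ?w @ [?b]"
    using arg_cong[OF alt_word_double_snoc[of n], of "\<lambda>u. u @ [?b]"] by simp
  moreover have "([?b] @ ?w @ [?b], [?b] @ [] @ [?b]) \<in> ?R"
    by (intro word_cong_append_left word_cong_append_right word_cong.relation)
      (simp add: dihedral_relations_def)
  moreover have "([?b] @ [] @ [?b], []) \<in> ?R"
    using word_cong_double_letter[of Gen_b "[]"] by simp
  ultimately show ?thesis by (metis word_cong.sym word_cong.trans)
qed

text \<open>A letter either lengthens an alternating word or cancels its first letter. The
  wrap-around cases are length 2n, which collapses to the empty word, and b before the empty word,
  which has normal form of length 2n - 1.\<close>

lemma letter_alt_word: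
  assumes "n > 0" "k < 2 * n"
  shows "((x, True) # alt_word k, alt_word (nat (letter_step x (int k) mod (2 * int n))))
    \<in> word_cong (dihedral_relations n)"
proof -
  let ?R = "word_cong (dihedral_relations n)"
  \<comment> \<open>\<open>up\<close> says that x is the letter that continues the alternating
    word.\<close>
  define up where "up \<longleftrightarrow> (x = Gen_a) = even k"
  show ?thesis
  proof (cases up)
    case True
    then have step: "letter_step x (int k) = int k + 1"
      and word: "(x, True) # alt_word k = alt_word (Suc k)"
      by (cases x; auto simp: up_def)+
    show ?thesis
    proof (cases "Suc k = 2 * n")
      case True
      then have "int k + 1 = 2 * int n" by linarith
      then show ?thesis using alt_word_double[of n] True by (simp only: step word) simp
    next
      case False
      then have "nat ((int k + 1) mod (2 * int n)) = Suc k" using assms by auto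
      then show ?thesis by (simp only: step word word_cong.refl)
    qed
  next
    case False
    then have step: "letter_step x (int k) = int k - 1"
      by (cases x; auto simp: up_def)
    show ?thesis
    proof (cases k)
      case 0
      then have x: "x = Gen_b" using False by (cases x) (auto simp: up_def)
      define j where "j = 2 * n - 1"
      have j: "2 * n = Suc j" "odd j" using assms by (auto simp: j_def)
      have "(- 1) mod (2 * int n) = 2 * int n - 1"
        using assms by (simp add: zmod_minus1)
      then have "nat ((int k - 1) mod (2 * int n)) = j"
        using 0 j(1) by simp
      \<comment> \<open>The word b followed by \<open>alt_word (2 * n)\<close> is reduced in two
        ways: the long factor is trivial, and its own leading b cancels with the first
        letter.\<close>
      moreover have "([(Gen_b, True)] @ alt_word (2 * n), [(Gen_b, True)] @ []) \<in> ?R"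
        by (rule word_cong_append_left[OF alt_word_double])
      moreover have "([(Gen_b, True)] @ alt_word (2 * n), alt_word j) \<in> ?R"
        using word_cong_double_letter[of Gen_b] j by simp
      ultimately show ?thesis
        unfolding step by (metis "0" alt_word.simps(1) append_Cons append_Nil word_cong.sym word_cong.trans x)
    next
      case (Suc j)
      then have "alt_word k = (x, True) # alt_word j"
        using False by (cases x) (auto simp: up_def)
      moreover have "nat ((int k - 1) mod (2 * int n)) = j" using Suc assms by auto
      ultimately show ?thesis by (simp only: step word_cong_double_letter)
    qed
  qed
qed

lemma word_cong_alt_word:
  assumes "n > 0"
  shows "(w, alt_word (nat (word_step w 0 mod (2 * int n)))) \<in> word_cong (dihedral_relations n)"
proof (induction w)
  case Nil
  then show ?case by (simp add: word_cong.refl)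
next
  case (Cons l w)
  obtain x s where l: "l = (x, s)" by (cases l)
  let ?R = "word_cong (dihedral_relations n)"
  define k where "k = nat (word_step w 0 mod (2 * int n))"
  have ik: "int k = word_step w 0 mod (2 * int n)" using assms by (simp add: k_def)
  then have k: "k < 2 * n"
    by (metis assms of_nat_0_less_iff of_nat_less_iff of_nat_mult of_nat_numeral pos_mod_bound
        zero_less_mult_iff zero_less_numeral)
  have "([(x, s)] @ w, [(x, True)] @ alt_word k) \<in> ?R"
    using Cons.IH by (intro word_cong.append word_cong_letter) (simp add: k_def)
  moreover have "([(x, True)] @ alt_word k, alt_word (nat (letter_step x (int k) mod (2 * int n)))) \<in> ?R"
    using letter_alt_word[OF assms k] by simp
  moreover have "letter_step x (int k) mod (2 * int n) = letter_step x (word_step w 0) mod (2 * int n)"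
    using word_step_cong[of "int k" "word_step w 0" n "[(x, s)]"] by (simp add: ik cong_def)
  ultimately show ?case by (auto simp: l intro: word_cong.trans)
qed

text \<open>Congruent words move 0 alike; conversely, the normal form depends only on the residue of
  the image of 0.\<close>

lemma word_cong_iff:
  assumes "n > 0"
  shows "(u, v) \<in> word_cong (dihedral_relations n) \<longleftrightarrow>
    [word_step u 0 = word_step v 0] (mod 2 * int n)"
  using word_step_word_cong[of u v n 0] word_cong_alt_word[OF assms, of u]
    word_cong_alt_word[OF assms, of v]
  unfolding cong_def by (metis word_cong.sym word_cong.trans)

definition dihedral_elem :: "nat \<Rightarrow> int \<Rightarrow> dihedral_letter gword set" where
  "dihedral_elem n k = word_cong (dihedral_relations n) `` {alt_word (nat (k mod (2 * int n)))}"

lemma word_class_eq_dihedral_elem: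
  assumes "n > 0"
  shows "word_cong (dihedral_relations n) `` {w} = dihedral_elem n (word_step w 0)"
  unfolding dihedral_elem_def by (rule equiv_class_eq[OF equiv_word_cong word_cong_alt_word[OF assms]])

lemma dihedral_elem_eq_iff:
  assumes "n > 0"
  shows "dihedral_elem n i = dihedral_elem n j \<longleftrightarrow> [i = j] (mod 2 * int n)"
  using assms
  by (simp add: dihedral_elem_def eq_equiv_class_iff[OF equiv_word_cong] word_cong_iff
      word_step_alt_word)

lemma carrier_dihedral_group:
  assumes "n > 0"
  shows "carrier (dihedral_group n) = range (dihedral_elem n)"
proof
  show "carrier (dihedral_group n) \<subseteq> range (dihedral_elem n)"
    by (auto simp: dihedral_group_def presented_group_def word_class_eq_dihedral_elem[OF assms]
        elim!: quotientE)
  show "range (dihedral_elem n) \<subseteq> carrier (dihedral_group n)"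
    by (auto simp: dihedral_group_def dihedral_elem_def word_class_in_carrier)
qed

text \<open>This turns left multiplication into motion on the cycle, the form in which adjacency is
  read off.\<close>

lemma word_class_mult_dihedral_elem:
  assumes "n > 0"
  shows "word_cong (dihedral_relations n) `` {w} \<otimes>\<^bsub>dihedral_group n\<^esub> dihedral_elem n i =
    dihedral_elem n (word_step w i)"
proof -
  let ?c = "\<lambda>w. word_cong (dihedral_relations n) `` {w}"
  let ?v = "alt_word (nat (i mod (2 * int n)))"
  have "?c w \<otimes>\<^bsub>dihedral_group n\<^esub> dihedral_elem n i = ?c (w @ ?v)"
    by (simp only: dihedral_group_def dihedral_elem_def presented_group_mult)
  also have "\<dots> = dihedral_elem n (word_step w (i mod (2 * int n)))"
    using assms by (simp add: word_class_eq_dihedral_elem word_step_alt_word)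
  also have "\<dots> = dihedral_elem n (word_step w i)"
    unfolding dihedral_elem_eq_iff[OF assms] by (rule word_step_cong) (simp add: cong_def)
  finally show ?thesis .
qed

section \<open>The Cayley graph\<close>

lemma boundary_set_dihedral:
  assumes "n \<ge> 3"
  shows "boundary_set (dihedral_group n) {\<one>\<^bsub>dihedral_group n\<^esub>, dihedral_a n, dihedral_b n} =
    (\<lambda>w. word_cong (dihedral_relations n) `` {w}) `
      {[(Gen_a, True)], [(Gen_b, True)], [(Gen_a, True), (Gen_b, True)], [(Gen_b, True), (Gen_a, True)]}"
proof -
  let ?G = "dihedral_group n"
  let ?c = "\<lambda>w. word_cong (dihedral_relations n) `` {w}"
  interpret group ?G by (rule group_dihedral_group)
  have n: "n > 0" using assms by simp
  have ab: "dihedral_a n = ?c [(Gen_a, True)]" "dihedral_b n = ?c [(Gen_b, True)]"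
    by (simp_all add: dihedral_a_def dihedral_b_def presented_gen_def)
  have one: "\<one>\<^bsub>?G\<^esub> = ?c []" by (simp add: dihedral_group_def presented_group_one)
  have mult: "?c u \<otimes>\<^bsub>?G\<^esub> ?c v = ?c (u @ v)" for u v
    by (simp add: dihedral_group_def presented_group_mult)
  have sq: "?c [(x, True), (x, True)] = ?c []" for x
    by (rule equiv_class_eq[OF equiv_word_cong word_cong_double_letter])
  have car: "?c u \<in> carrier ?G" for u by (simp add: dihedral_group_def word_class_in_carrier)
  have inv: "inv\<^bsub>?G\<^esub> ?c [(x, True)] = ?c [(x, True)]" for x
    by (rule inv_equality) (simp_all add: mult sq one car)
  have inv1: "inv\<^bsub>?G\<^esub> ?c [] = ?c []" using one inv_one by simp
  \<comment> \<open>The words a, b, ba, ab send 0 to 1, -1, 2, -2 respectively, and none of these is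
    a multiple of 2n, which is at least 6.\<close>
  have neq: "?c w \<noteq> ?c []" if "word_step w 0 \<in> {1, -1, 2, -2}" for w
  proof
    assume "?c w = ?c []"
    then have "2 * int n dvd word_step w 0"
      using n by (simp add: word_class_eq_dihedral_elem dihedral_elem_eq_iff cong_iff_dvd_diff)
    then have "2 * int n \<le> \<bar>word_step w 0\<bar>" using that by (intro zdvd_imp_le) auto
    then show False using that assms by auto
  qed
  have "{inv\<^bsub>?G\<^esub> x \<otimes>\<^bsub>?G\<^esub> y |x y. x \<in> {?c [], ?c [(Gen_a, True)], ?c [(Gen_b, True)]} \<and>
        y \<in> {?c [], ?c [(Gen_a, True)], ?c [(Gen_b, True)]}} =
      insert (?c []) (?c ` {[(Gen_a, True)], [(Gen_b, True)], [(Gen_a, True), (Gen_b, True)],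
        [(Gen_b, True), (Gen_a, True)]})" (is "?L = ?R")
  proof
    show "?L \<subseteq> ?R" by (auto simp: inv inv1 mult sq)
    have L: "inv\<^bsub>?G\<^esub> x \<otimes>\<^bsub>?G\<^esub> y \<in> ?L"
      if "x \<in> {?c [], ?c [(Gen_a, True)], ?c [(Gen_b, True)]}"
        "y \<in> {?c [], ?c [(Gen_a, True)], ?c [(Gen_b, True)]}" for x y
      using that by blast
    show "?R \<subseteq> ?L"
      using L[of "?c []" "?c []"] L[of "?c []" "?c [(Gen_a, True)]"] L[of "?c []" "?c [(Gen_b, True)]"]
        L[of "?c [(Gen_a, True)]" "?c [(Gen_b, True)]"] L[of "?c [(Gen_b, True)]" "?c [(Gen_a, True)]"]
      by (simp add: inv inv1 mult)
  qed
  moreover have "?c [] \<notin> ?c ` {[(Gen_a, True)], [(Gen_b, True)], [(Gen_a, True), (Gen_b, True)],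
        [(Gen_b, True), (Gen_a, True)]}"
    using neq[symmetric] by auto
  ultimately show ?thesis unfolding boundary_set_def ab one by blast
qed

lemma cycle_square_cayley_dihedral:
  assumes "n \<ge> 3"
    and S: "S = boundary_set (dihedral_group n) {\<one>\<^bsub>dihedral_group n\<^esub>, dihedral_a n, dihedral_b n}"
  shows "cycle_square (cayley_graph (dihedral_group n) S) (2 * n) (dihedral_elem n)"
proof
  let ?G = "dihedral_group n"
  let ?c = "\<lambda>w. word_cong (dihedral_relations n) `` {w}"
  let ?W = "{[(Gen_a, True)], [(Gen_b, True)], [(Gen_a, True), (Gen_b, True)], [(Gen_b, True), (Gen_a, True)]}"
  interpret group ?G by (rule group_dihedral_group)
  have n: "n > 0" using assms by simp
  show "pverts (cayley_graph ?G S) = range (dihedral_elem n)"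
    by (simp add: cayley_graph_def carrier_dihedral_group[OF n])
  show "dihedral_elem n i = dihedral_elem n j \<longleftrightarrow> [i = j] (mod int (2 * n))" for i j
    by (simp add: dihedral_elem_eq_iff[OF n])
  show "2 * n \<ge> 3" using assms by simp
  show "(dihedral_elem n i, dihedral_elem n j) \<in> parcs (cayley_graph ?G S) \<longleftrightarrow>
      (\<exists>d\<in>{1, -1, 2, -2}. dihedral_elem n j = dihedral_elem n (i + d))" for i j
  proof -
    have car: "dihedral_elem n k \<in> carrier ?G" for k by (simp add: carrier_dihedral_group[OF n])
    have carc: "?c w \<in> carrier ?G" for w by (simp add: dihedral_group_def word_class_in_carrier)
    have "dihedral_elem n j \<otimes>\<^bsub>?G\<^esub> inv\<^bsub>?G\<^esub> dihedral_elem n i = ?c w \<longleftrightarrow>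
        dihedral_elem n j = dihedral_elem n (word_step w i)" for w
    proof -
      \<comment> \<open>A vertex v is joined to u through s exactly when v = su, so neighbours arise
        by left multiplication.\<close>
      have "dihedral_elem n j \<otimes>\<^bsub>?G\<^esub> inv\<^bsub>?G\<^esub> dihedral_elem n i = ?c w \<longleftrightarrow>
          dihedral_elem n j = ?c w \<otimes>\<^bsub>?G\<^esub> dihedral_elem n i"
        using car carc inv_solve_right' by (metis inv_closed inv_inv)
      then show ?thesis by (simp only: word_class_mult_dihedral_elem[OF n])
    qed
    then have "(dihedral_elem n i, dihedral_elem n j) \<in> parcs (cayley_graph ?G S) \<longleftrightarrow>
        (\<exists>w\<in>?W. dihedral_elem n j = dihedral_elem n (word_step w i))"
      by (simp add: cayley_graph_def car S boundary_set_dihedral[OF assms(1)])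
    \<comment> \<open>From an even position a, b, ba, ab move by 1, -1, 2, -2; from an odd one all
      signs flip, which leaves the set of offsets unchanged.\<close>
    also have "\<dots> \<longleftrightarrow> (\<exists>d\<in>{1, -1, 2, -2}. dihedral_elem n j = dihedral_elem n (i + d))"
      by (cases "even i") (simp_all add: disj_ac add.commute)
    finally show ?thesis .
  qed
qed

theorem lemma8:
  fixes n :: nat
    and S :: "dihedral_letter gword set set"
  assumes "n \<ge> 3"
    and "S = boundary_set (dihedral_group n) {\<one>\<^bsub>dihedral_group n\<^esub>, dihedral_a n, dihedral_b n}"
  shows "int (independent_domination_number (cayley_graph (dihedral_group n) S)) = \<lceil>2 * real n / 5\<rceil>
       \<and> int (independence_number (cayley_graph (dihedral_group n) S)) = \<lfloor>2 * real n / 3\<rfloor>"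
proof -
  interpret cycle_square "cayley_graph (dihedral_group n) S" "2 * n" "dihedral_elem n"
    using assms by (rule cycle_square_cayley_dihedral)
  define m where "m = (2 * n + 4) div 5"
  have m: "2 * n \<le> 5 * m" "5 * m < 2 * n + 5" by (auto simp: m_def)
  \<comment> \<open>From \<open>5 * m \<le> 2 * n + 4\<close> this follows once 6n + 12 is at most
    10n, that is, for n at least 3; equality occurs at n = 3.\<close>
  have "3 * m \<le> 2 * n" using m assms(1) by linarith
  from independent_domination_number_eq[OF this m]
  have "independent_domination_number (cayley_graph (dihedral_group n) S) = m" .
  moreover have "\<lceil>2 * real n / 5\<rceil> = int m"
    using m by (intro ceiling_unique) linarith+
  moreover have "\<lfloor>2 * real n / 3\<rfloor> = int (2 * n div 3)"
    using floor_divide_of_nat_eq[of "2 * n" 3] by simp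
  ultimately show ?thesis by (simp add: independence_number_eq)
qed

end
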